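(* Let $(\mathfrak g,\{-,\cdots,-\})$ be an $n$-pre-Lie algebra and define the skew-symmetric multilinear map $L:\wedge^{n-1}\mathfrak g\to\mathfrak{gl}(\mathfrak g)$ by $L(x_1,\cdots,x_{n-1})(x_n)=\{x_1,\cdots,x_{n-1},x_n\}$ for all $x_1,\cdots,x_n\in\mathfrak g$. Then $(\mathfrak g;L)$ is a representation of the $n$-Lie algebra $(\mathfrak g,[-,\cdots,-]_C)$.
   Context: All vector spaces are finite dimensional over an algebraically closed field of characteristic $0$; $n\ge2$; a hat denotes omission. An $n$-Lie algebra is a vector space $\mathfrak g$ with a skew-symmetric linear map $[-,\cdots,-]_{\mathfrak g}:\wedge^n\mathfrak g\to\mathfrak g$ such that $[x_1,\cdots,x_{n-1},[y_1,\cdots,y_n]]=\sum_{i=1}^n[y_1,\cdots,y_{i-1},[x_1,\cdots,x_{n-1},y_i],y_{i+1},\cdots,y_n]$. A representation of it on $V$ is a linear map $\rho:\wedge^{n-1}\mathfrak g\to\mathfrak{gl}(V)$ with (i) $[\rho(\mathfrak X),\rho(\mathfrak Y)]=\rho(\mathfrak X\circ\mathfrak Y)$ (commutator on the left), where for $\mathfrak X=x_1\wedge\cdots\wedge x_{n-1}$, $\mathfrak Y=y_1\wedge\cdots\wedge y_{n-1}$, $\mathfrak X\circ\mathfrak Y=\sum_{i=1}^{n-1}y_1\wedge\cdots\wedge[x_1,\cdots,x_{n-1},y_i]_{\mathfrak g}\wedge\cdots\wedge y_{n-1}$; and (ii) $\rho(x_1,\cdots,x_{n-2},[y_1,\cdots,y_n]_{\mathfrak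 g})=\sum_{i=1}^n(-1)^{n-i}\rho(y_1,\cdots,\widehat{y_i},\cdots,y_n)\rho(x_1,\cdots,x_{n-2},y_i)$. An $n$-pre-Lie algebra is a vector space $\mathfrak g$ with a multilinear map $\{-,\cdots,-\}:\wedge^{n-1}\mathfrak g\otimes\mathfrak g\to\mathfrak g$ such that for all $x_i,y_j\in\mathfrak g$: (1) $\{x_1,\cdots,x_{n-1},\{y_1,\cdots,y_{n-1},y_n\}\}=\sum_{i=1}^{n-1}\{y_1,\cdots,y_{i-1},[x_1,\cdots,x_{n-1},y_i]_C,y_{i+1},\cdots,y_n\}+\{y_1,\cdots,y_{n-1},\{x_1,\cdots,x_{n-1},y_n\}\}$; (2) $\{[y_1,\cdots,y_n]_C,x_1,\cdots,x_{n-2},x_{n-1}\}=\sum_{i=1}^n(-1)^{n-i}\{y_1,\cdots,\widehat{y_i},\cdots,y_n,\{y_i,x_1,\cdots,x_{n-2},x_{n-1}\}\}$, where $[x_1,\cdots,x_n]_C=\sum_{i=1}^n(-1)^{n-i}\{x_1,\cdots,\widehat{x_i},\cdots,x_n,x_i\}$. The bracket $[-,\cdots,-]_C$ is an $n$-Lie bracket on $\mathfrak g$; $(\mathfrak g,[-,\cdots,-]_C)$ is called the sub-adjacent $n$-Lie algebra. *)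

theory Defs
  imports "HOL-Computational_Algebra.Polynomial"
begin

text \<open>
  An \<open>m\<close>-tuple of vectors is a list of length \<open>m\<close>; values of maps on lists of any other length
  are irrelevant.  List positions start at \<open>0\<close>, so the sign \<open>(-1)^(n - i)\<close> attached to the
  \<open>i\<close>-th of \<open>n\<close> entries counted from \<open>1\<close> becomes \<open>(-1)^(n - Suc i)\<close>.
  A linear map out of an exterior power is given as the corresponding skew-symmetric
  multilinear map; the two notions agree because all scalars have characteristic \<open>0\<close>.
\<close>

definition omit_nth :: "nat \<Rightarrow> 'a list \<Rightarrow> 'a list" where
  "omit_nth i xs = take i xs @ drop (Suc i) xs"

definition multilinear ::
  "nat \<Rightarrow> ('k::field \<Rightarrow> 'a::ab_group_add \<Rightarrow> 'a) \<Rightarrow> ('k \<Rightarrow> 'b::ab_group_add \<Rightarrow> 'b) \<Rightarrow> ('a list \<Rightarrow> 'b) \<Rightarrow> bool"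
  where
  "multilinear m sA sB f \<longleftrightarrow>
     (\<forall>xs i. length xs = m \<longrightarrow> i < m \<longrightarrow> Vector_Spaces.linear sA sB (\<lambda>v. f (xs[i := v])))"

definition skew_symmetric :: "nat \<Rightarrow> ('a list \<Rightarrow> 'b::ab_group_add) \<Rightarrow> bool" where
  "skew_symmetric m f \<longleftrightarrow>
     (\<forall>xs i j. length xs = m \<longrightarrow> i < m \<longrightarrow> j < m \<longrightarrow> i \<noteq> j \<longrightarrow>
        f (xs[i := xs ! j, j := xs ! i]) = - f xs)"

locale fin_dim_space = vector_space scale
  for scale :: "'k::{alg_closed_field,field_char_0} \<Rightarrow> 'g::ab_group_add \<Rightarrow> 'g" +
  assumes finite_dim: "\<exists>B. finite_dimensional_vector_space scale B"

locale n_Lie_algebra = fin_dim_space scale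
  for n :: nat
  and scale :: "'k::{alg_closed_field,field_char_0} \<Rightarrow> 'g::ab_group_add \<Rightarrow> 'g"
  and br :: "'g list \<Rightarrow> 'g" +
  assumes n_ge_2: "n \<ge> 2"
    and br_multilinear: "multilinear n scale scale br"
    and br_skew: "skew_symmetric n br"
    and fundamental_identity:
      "\<lbrakk>length xs = n - 1; length ys = n\<rbrakk> \<Longrightarrow>
         br (xs @ [br ys]) = (\<Sum>i<n. br (ys[i := br (xs @ [ys ! i])]))"

text \<open>
  The linear structure on the endomorphisms of \<open>V\<close> is pointwise, so multilinearity and
  skew-symmetry of \<open>\<rho>\<close> and the equations between endomorphisms are stated at each vector \<open>v\<close>.
\<close>

locale n_Lie_representation =
  n_Lie_algebra n scale br + V: fin_dim_space scaleV
  for n :: nat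
  and scale :: "'k::{alg_closed_field,field_char_0} \<Rightarrow> 'g::ab_group_add \<Rightarrow> 'g"
  and br :: "'g list \<Rightarrow> 'g"
  and scaleV :: "'k \<Rightarrow> 'v::ab_group_add \<Rightarrow> 'v"
  and \<rho> :: "'g list \<Rightarrow> 'v \<Rightarrow> 'v" +
  assumes rho_endo: "length xs = n - 1 \<Longrightarrow> Vector_Spaces.linear scaleV scaleV (\<rho> xs)"
    and rho_multilinear: "multilinear (n - 1) scale scaleV (\<lambda>xs. \<rho> xs v)"
    and rho_skew: "skew_symmetric (n - 1) (\<lambda>xs. \<rho> xs v)"
    and rho_commutator:
      "\<lbrakk>length xs = n - 1; length ys = n - 1\<rbrakk> \<Longrightarrow>
         \<rho> xs (\<rho> ys v) - \<rho> ys (\<rho> xs v) = (\<Sum>i<n - 1. \<rho> (ys[i := br (xs @ [ys ! i])]) v)"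
    and rho_bracket:
      "\<lbrakk>length xs = n - 2; length ys = n\<rbrakk> \<Longrightarrow>
         \<rho> (xs @ [br ys]) v =
           (\<Sum>i<n. scaleV ((- 1) ^ (n - Suc i)) (\<rho> (omit_nth i ys) (\<rho> (xs @ [ys ! i]) v)))"

definition subadjacent_bracket ::
  "nat \<Rightarrow> ('k::field \<Rightarrow> 'g::ab_group_add \<Rightarrow> 'g) \<Rightarrow> ('g list \<Rightarrow> 'g) \<Rightarrow> 'g list \<Rightarrow> 'g" where
  "subadjacent_bracket n scale p xs =
     (\<Sum>i<n. scale ((- 1) ^ (n - Suc i)) (p (omit_nth i xs @ [xs ! i])))"

locale n_pre_Lie_algebra = fin_dim_space scale
  for n :: nat
  and scale :: "'k::{alg_closed_field,field_char_0} \<Rightarrow> 'g::ab_group_add \<Rightarrow> 'g"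
  and p :: "'g list \<Rightarrow> 'g" +
  assumes n_ge_2: "n \<ge> 2"
    and p_multilinear: "multilinear n scale scale p"
    and p_skew: "skew_symmetric (n - 1) (\<lambda>xs. p (xs @ [z]))"
    and pre_Lie_1:
      "\<lbrakk>length xs = n - 1; length ys = n - 1\<rbrakk> \<Longrightarrow>
         p (xs @ [p (ys @ [z])]) =
           (\<Sum>i<n - 1. p (ys[i := subadjacent_bracket n scale p (xs @ [ys ! i])] @ [z]))
           + p (ys @ [p (xs @ [z])])"
    and pre_Lie_2:
      "\<lbrakk>length xs = n - 1; length ys = n\<rbrakk> \<Longrightarrow>
         p (subadjacent_bracket n scale p ys # xs) =
           (\<Sum>i<n. scale ((- 1) ^ (n - Suc i)) (p (omit_nth i ys @ [p (ys ! i # xs)])))"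

definition left_mult :: "('g list \<Rightarrow> 'g) \<Rightarrow> 'g list \<Rightarrow> 'g \<Rightarrow> 'g" where
  "left_mult p xs x = p (xs @ [x])"

end

theory Submission
  imports Defs
begin

text \<open>
  The representation axioms are the two pre-Lie identities, up to moving one entry through
  \<open>n - 2\<close> others.  For the fundamental identity, write \<open>A u\<close> for \<open>[x\<^sub>1, \<dots>, x\<^sub>n\<^sub>-\<^sub>1, u]\<close> and \<open>L u\<close>
  for \<open>{x\<^sub>1, \<dots>, x\<^sub>n\<^sub>-\<^sub>1, u}\<close>, and let \<open>Y\<^sub>i\<close> be the tuple of the \<open>y\<^sub>j\<close> with \<open>y\<^sub>i\<close> omitted.
  In the expansion of \<open>A [y\<^sub>1, \<dots>, y\<^sub>n]\<close>, the term in which the inner bracket stands last is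
  rewritten by the first identity: it produces the terms \<open>{Y\<^sub>i, y\<^sub>i}\<close> with \<open>A\<close> applied to one
  entry of \<open>Y\<^sub>i\<close>, and the terms \<open>{Y\<^sub>i, L y\<^sub>i}\<close>.  The others are rewritten by the second identity
  and add up to the terms \<open>{Y\<^sub>i, A y\<^sub>i - L y\<^sub>i}\<close>, so that \<open>L\<close> cancels.
\<close>

section \<open>Lists with one entry omitted\<close>

text \<open>The position in a list of the \<open>m\<close>-th entry that remains after the \<open>i\<close>-th one is omitted.\<close>

definition skip :: "nat \<Rightarrow> nat \<Rightarrow> nat" where
  "skip i m = (if m < i then m else Suc m)"

lemma skip_neq [simp]: "skip i m \<noteq> i"
  by (simp add: skip_def)

lemma skip_less: "m < n - 1 \<Longrightarrow> skip i m < n"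
  by (auto simp: skip_def)

lemma ex_skip:
  assumes "k < n" "i < n" "k \<noteq> i"
  obtains m where "m < n - 1" "k = skip i m"
proof (cases "k < i")
  case True
  then show ?thesis using assms that[of k] by (simp add: skip_def)
next
  case False
  then show ?thesis using assms that[of "k - 1"] by (simp add: skip_def)
qed

lemma bij_betw_skip:
  assumes "i < n"
  shows "bij_betw (skip i) {..<n - 1} ({..<n} - {i})"
proof (rule bij_betw_imageI)
  show "inj_on (skip i) {..<n - 1}"
    by (auto simp: inj_on_def skip_def split: if_splits)
  show "skip i ` {..<n - 1} = {..<n} - {i}"
    using assms by (auto simp: skip_less elim: ex_skip[of _ n i])
qed

text \<open>This separates an update at the omitted position \<open>i\<close> from updates at the
  positions that survive the omission.\<close>

lemma sum_skip:
  fixes h :: "nat \<Rightarrow> 'b::ab_group_add"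
  assumes "i < n"
  shows "(\<Sum>k<n. h k) = (\<Sum>m<n - 1. h (skip i m)) + h i"
proof -
  have "(\<Sum>k<n. h k) = h i + (\<Sum>k\<in>{..<n} - {i}. h k)"
    using assms by (intro sum.remove) auto
  also have "(\<Sum>k\<in>{..<n} - {i}. h k) = (\<Sum>m<n - 1. h (skip i m))"
    by (rule sum.reindex_bij_betw[symmetric], rule bij_betw_skip[OF assms])
  finally show ?thesis by (simp add: add.commute)
qed

lemma length_omit_nth [simp]: "i < length xs \<Longrightarrow> length (omit_nth i xs) = length xs - 1"
  by (simp add: omit_nth_def)

lemma nth_omit_nth:
  "i < length xs \<Longrightarrow> m < length xs - 1 \<Longrightarrow> omit_nth i xs ! m = xs ! skip i m"
  by (auto simp: omit_nth_def skip_def nth_append)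

lemma omit_nth_update_same [simp]: "omit_nth i (xs[i := v]) = omit_nth i xs"
  by (simp add: omit_nth_def)

lemma omit_nth_update_skip:
  assumes "i < length xs" "m < length xs - 1"
  shows "omit_nth i (xs[skip i m := v]) = (omit_nth i xs)[m := v]"
  by (rule nth_equalityI)
     (use assms in \<open>auto simp: nth_omit_nth nth_list_update skip_less,
                    auto simp: skip_def split: if_splits\<close>)

lemma omit_nth_append: "i < length xs \<Longrightarrow> omit_nth i (xs @ ys) = omit_nth i xs @ ys"
  by (simp add: omit_nth_def)

lemma omit_nth_append_Cons: "omit_nth (length xs) (xs @ u # ys) = xs @ ys"
  by (simp add: omit_nth_def)

section \<open>Skew-symmetric maps\<close>

lemma skew_symmetricD:
  "skew_symmetric m f \<Longrightarrow> length xs = m \<Longrightarrow> i < m \<Longrightarrow> j < m \<Longrightarrow> i \<noteq> j \<Longrightarrow>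
     f (xs[i := xs ! j, j := xs ! i]) = - f xs"
  by (simp add: skew_symmetric_def)

text \<open>Each adjacent swap carries \<open>u\<close> past one entry of \<open>bs\<close> and
  costs one sign; in the induction the entry just passed joins \<open>as\<close>.\<close>

lemma (in vector_space) skew_symmetric_move:
  assumes "skew_symmetric m f" "length (as @ u # bs @ cs) = m"
  shows "f (as @ u # bs @ cs) = scale ((- 1) ^ length bs) (f (as @ bs @ u # cs))"
  using assms(2)
proof (induction bs arbitrary: as)
  case (Cons b bs)
  have "f (as @ u # b # bs @ cs) = - f (as @ b # u # bs @ cs)"
    using skew_symmetricD[OF assms(1), of "as @ b # u # bs @ cs" "length as" "Suc (length as)"] Cons.prems
    by (simp add: nth_append list_update_append)
  also have "f (as @ b # u # bs @ cs) = scale ((- 1) ^ length bs) (f (as @ b # bs @ u # cs))"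
    using Cons.IH[of "as @ [b]"] Cons.prems by simp
  finally show ?case by simp
qed simp

section \<open>Multilinearity and skew-symmetry of the sub-adjacent bracket\<close>

context n_pre_Lie_algebra
begin

abbreviation sbr :: "'g list \<Rightarrow> 'g" where
  "sbr \<equiv> subadjacent_bracket n scale p"

lemma p_linear:
  assumes "length xs = n" "i < n"
  shows "Vector_Spaces.linear scale scale (\<lambda>v. p (xs[i := v]))"
  using p_multilinear assms unfolding multilinear_def by blast

lemma p_linear_last:
  assumes "length xs = n - 1"
  shows "Vector_Spaces.linear scale scale (\<lambda>v. p (xs @ [v]))"
proof -
  \<comment> \<open>The entry \<open>0\<close> is only a placeholder, overwritten by
    \<open>v\<close>.\<close>
  have "(xs @ [0])[n - 1 := v] = xs @ [v]" for v
    using assms by (simp add: list_update_append)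
  then show ?thesis using p_linear[of "xs @ [0]" "n - 1"] assms n_ge_2 by simp
qed

lemma p_linear_init:
  assumes "length xs = n - 1" "i < n - 1"
  shows "Vector_Spaces.linear scale scale (\<lambda>v. p (xs[i := v] @ [z]))"
proof -
  have "(xs @ [z])[i := v] = xs[i := v] @ [z]" for v
    using assms by (simp add: list_update_append)
  then show ?thesis using p_linear[of "xs @ [z]" i] assms n_ge_2 by simp
qed

lemma sbr_multilinear: "multilinear n scale scale sbr"
  unfolding multilinear_def
proof (intro allI impI)
  fix xs :: "'g list" and k
  assume xs: "length xs = n" and k: "k < n"
  interpret vector_space_pair scale scale ..
  have "Vector_Spaces.linear scale scale (\<lambda>v. p (omit_nth i (xs[k := v]) @ [xs[k := v] ! i]))"
    if i: "i < n" for i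
  proof (cases "k = i")
    case True
    then show ?thesis using p_linear_last[of "omit_nth i xs"] xs i by simp
  next
    case False
    then obtain m where "m < n - 1" "k = skip i m" using ex_skip k i by blast
    then show ?thesis
      using p_linear_init[of "omit_nth i xs" m "xs ! i"] xs i by (simp add: omit_nth_update_skip)
  qed
  then show "Vector_Spaces.linear scale scale (\<lambda>v. sbr (xs[k := v]))"
    unfolding subadjacent_bracket_def
    by (intro linear_compose_sum ballI linear_compose_scale_right) auto
qed

text \<open>A term that omits neither \<open>i\<close> nor \<open>j\<close> changes sign because
  \<open>p\<close> is skew in its first \<open>n - 1\<close> arguments. The two remaining terms have
  \<open>a\<close> or \<open>b\<close> in the last argument, where \<open>p\<close> need not be
  skew; the swap exchanges them, up to moving an entry across \<open>bs\<close>.\<close>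

lemma sbr_swap:
  assumes xs: "length xs = n" and ij: "i < j" "j < n"
  shows "sbr (xs[i := xs ! j, j := xs ! i]) = - sbr xs"
proof -
  define ys where "ys = xs[i := xs ! j, j := xs ! i]"
  define t where "t zs k = scale ((- 1) ^ (n - Suc k)) (p (omit_nth k zs @ [zs ! k]))" for zs k
  define as bs cs where "as = take i xs" and "bs = take (j - Suc i) (drop (Suc i) xs)"
    and "cs = drop (Suc j) xs"
  define a b where "a = xs ! i" and "b = xs ! j"
  have xs_eq: "xs = as @ a # bs @ b # cs"
  proof -
    have "xs = as @ a # drop (Suc i) xs"
      unfolding as_def a_def using xs ij by (intro id_take_nth_drop) auto
    also have "drop (Suc i) xs = bs @ b # cs"
      unfolding bs_def b_def cs_def
      using xs ij id_take_nth_drop[of "j - Suc i" "drop (Suc i) xs"] by simp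
    finally show ?thesis .
  qed
  have len: "length as = i" "length bs = j - Suc i"
    using xs ij by (auto simp: as_def bs_def)
  have ys_eq: "ys = as @ b # bs @ a # cs"
    unfolding ys_def a_def[symmetric] b_def[symmetric]
    by (subst xs_eq) (use len ij in \<open>auto simp: list_update_append split: nat.splits\<close>)
  \<comment> \<open>\<open>n - Suc i\<close> exceeds the sum of \<open>n - Suc j\<close> and
    \<open>j - Suc i\<close> by one, which gives the minus sign.\<close>
  have sign: "(- 1) ^ (n - Suc j) * (- 1) ^ (j - Suc i) = - ((- 1) ^ (n - Suc i) :: 'k)"
  proof -
    obtain d where "j = Suc (i + d)" using ij less_imp_Suc_add by blast
    moreover obtain e where "n = Suc (j + e)" using ij less_imp_Suc_add by blast
    ultimately show ?thesis by (simp add: power_add)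
  qed
  have om: "omit_nth i xs = as @ bs @ b # cs" "omit_nth i ys = as @ bs @ a # cs"
    using omit_nth_append_Cons[of as] by (auto simp: xs_eq ys_eq len)
  have om': "omit_nth j xs = as @ a # bs @ cs" "omit_nth j ys = as @ b # bs @ cs"
    using omit_nth_append_Cons[of "as @ _ # bs"] len ij by (auto simp: xs_eq ys_eq)
  have nths: "xs ! i = a" "xs ! j = b" "ys ! i = b" "ys ! j = a"
    using xs ij by (auto simp: a_def b_def ys_def)
  have move: "p ((as @ u # bs @ cs) @ [z]) = scale ((- 1) ^ (j - Suc i)) (p ((as @ bs @ u # cs) @ [z]))"
    for u z
    using skew_symmetric_move[OF p_skew, of as u bs cs z] xs by (simp add: xs_eq len)
  \<comment> \<open>Both terms have \<open>b\<close> last; \<open>move\<close> aligns the positions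
    of \<open>a\<close>.\<close>
  have 1: "t ys i = - t xs j"
    using sign by (simp only: t_def om om' nths move scale_scale) simp
  have 2: "t ys j = - t xs i"
    using sign by (simp only: t_def om om' nths move scale_scale) simp
  have other: "t ys k = - t xs k" if k: "k < n" "k \<noteq> i" "k \<noteq> j" for k
  proof -
    \<comment> \<open>The positions of the two swapped entries once the \<open>k\<close>-th is
      omitted.\<close>
    obtain i' where i': "i' < n - 1" "i = skip k i'" using ex_skip k ij by (metis less_trans)
    obtain j' where j': "j' < n - 1" "j = skip k j'" using ex_skip k ij by metis
    have "i' \<noteq> j'" using i' j' ij by auto
    moreover have "omit_nth k ys =
        (omit_nth k xs)[i' := omit_nth k xs ! j', j' := omit_nth k xs ! i']"
      unfolding ys_def using xs k i' j' by (simp add: omit_nth_update_skip nth_omit_nth)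
    ultimately have "p (omit_nth k ys @ [xs ! k]) = - p (omit_nth k xs @ [xs ! k])"
      using skew_symmetricD[OF p_skew, of "omit_nth k xs" i' j' "xs ! k"] xs k i' j' by simp
    then show ?thesis using k by (simp add: t_def ys_def)
  qed
  have split: "(\<Sum>k<n. h k) = h i + (h j + (\<Sum>k\<in>{..<n} - {i} - {j}. h k))" for h :: "nat \<Rightarrow> 'g"
    using ij by (subst sum.remove[of _ i], simp, simp, subst sum.remove[of _ j]) auto
  have "(\<Sum>k<n. t ys k) = - (\<Sum>k<n. t xs k)"
    unfolding split by (simp add: 1 2 other sum_negf)
  then show ?thesis
    by (simp add: subadjacent_bracket_def t_def ys_def)
qed

lemma sbr_skew: "skew_symmetric n sbr"
  unfolding skew_symmetric_def
proof (intro allI impI)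
  fix xs :: "'g list" and i j
  assume xs: "length xs = n" and ij: "i < n" "j < n" "i \<noteq> j"
  show "sbr (xs[i := xs ! j, j := xs ! i]) = - sbr xs"
  proof (cases "i < j")
    case True
    then show ?thesis using sbr_swap xs ij by blast
  next
    case False
    then have "sbr (xs[j := xs ! i, i := xs ! j]) = - sbr xs" using sbr_swap xs ij by auto
    then show ?thesis using ij by (simp add: list_update_swap)
  qed
qed

section \<open>Second identity and fundamental identity\<close>

text \<open>\<open>pre_Lie_2\<close> has the bracket in front. Moving it, and each
  \<open>ys ! i\<close> on the right, past the \<open>n - 2\<close> entries of \<open>xs\<close>
  gives the same sign on both sides. The result serves both the fundamental identity and the second
  representation axiom.\<close>

lemma p_sbr:
  assumes xs: "length xs = n - 2" and ys: "length ys = n"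
  shows "p (xs @ [sbr ys, z]) =
    (\<Sum>i<n. scale ((- 1) ^ (n - Suc i)) (p (omit_nth i ys @ [p (xs @ [ys ! i, z])])))"
proof -
  have move: "p (xs @ [u, z]) = scale ((- 1) ^ (n - 2)) (p (u # xs @ [z]))" for u
  proof -
    have "p (u # xs @ [z]) = scale ((- 1) ^ (n - 2)) (p (xs @ [u, z]))"
      using skew_symmetric_move[OF p_skew, of "[]" u xs "[]" z] xs n_ge_2 by simp
    then show ?thesis by (simp flip: power_mult_distrib)
  qed
  have lin: "p (omit_nth i ys @ [scale c v]) = scale c (p (omit_nth i ys @ [v]))" if "i < n" for i c v
  proof -
    interpret Vector_Spaces.linear scale scale "\<lambda>v. p (omit_nth i ys @ [v])"
      using that ys by (intro p_linear_last) simp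
    show ?thesis by (rule scale)
  qed
  show ?thesis
    unfolding move
    using pre_Lie_2[of "xs @ [z]" ys] xs ys n_ge_2
    by (simp add: lin scale_sum_right mult.commute)
qed

text \<open>The last term omits \<open>u\<close> itself and has sign \<open>1\<close>. So the sum
  over \<open>j\<close> is the bracket minus \<open>p (xs @ [u])\<close>, which is how
  \<open>A - L\<close> arises below.\<close>

lemma sbr_snoc:
  assumes xs: "length xs = n - 1"
  shows "sbr (xs @ [u]) =
    (\<Sum>j<n - 1. scale ((- 1) ^ (n - Suc j)) (p (omit_nth j xs @ [u, xs ! j]))) + p (xs @ [u])"
proof -
  have "n = Suc (n - 1)" using n_ge_2 by simp
  then have "(\<Sum>j<n. h j) = (\<Sum>j<n - 1. h j) + h (n - 1)" for h :: "nat \<Rightarrow> 'g"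
    by (metis sum.lessThan_Suc)
  then show ?thesis
    using xs n_ge_2 omit_nth_append_Cons[of xs u "[]"]
    by (simp add: subadjacent_bracket_def omit_nth_append nth_append)
qed

lemma sbr_fundamental_identity:
  assumes xs: "length xs = n - 1" and ys: "length ys = n"
  shows "sbr (xs @ [sbr ys]) = (\<Sum>i<n. sbr (ys[i := sbr (xs @ [ys ! i])]))"
proof -
  define e :: "nat \<Rightarrow> 'k" where "e i = (- 1) ^ (n - Suc i)" for i
  define A where "A u = sbr (xs @ [u])" for u
  define Y where "Y i = omit_nth i ys" for i
  have Y: "length (Y i) = n - 1" if "i < n" for i
    using that ys by (simp add: Y_def)
  have lin: "Vector_Spaces.linear scale scale (\<lambda>v. p (Y i @ [v]))" if "i < n" for i
    by (rule p_linear_last[OF Y[OF that]])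
  have lin_xs: "Vector_Spaces.linear scale scale (\<lambda>v. p (xs @ [v]))"
    by (rule p_linear_last[OF xs])
  have last: "p (xs @ [sbr ys]) =
      (\<Sum>i<n. scale (e i) ((\<Sum>m<n - 1. p ((Y i)[m := A (Y i ! m)] @ [ys ! i])) + p (Y i @ [p (xs @ [ys ! i])])))"
  proof -
    interpret Lx: Vector_Spaces.linear scale scale "\<lambda>v. p (xs @ [v])" by (rule lin_xs)
    have "p (xs @ [sbr ys]) = (\<Sum>i<n. scale (e i) (p (xs @ [p (Y i @ [ys ! i])])))"
      unfolding subadjacent_bracket_def[of n scale p ys] by (simp add: Lx.sum Lx.scale e_def Y_def)
    then show ?thesis using pre_Lie_1[OF xs Y] by (simp add: A_def)
  qed
  have init: "(\<Sum>j<n - 1. scale (e j) (p (omit_nth j xs @ [sbr ys, xs ! j]))) =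
      (\<Sum>i<n. scale (e i) (p (Y i @ [A (ys ! i)]) - p (Y i @ [p (xs @ [ys ! i])])))"
  proof -
    have "(\<Sum>j<n - 1. scale (e j) (p (omit_nth j xs @ [sbr ys, xs ! j]))) =
        (\<Sum>j<n - 1. \<Sum>i<n. scale (e i) (scale (e j) (p (Y i @ [p (omit_nth j xs @ [ys ! i, xs ! j])]))))"
      using p_sbr[OF _ ys] xs by (intro sum.cong refl) (simp add: scale_sum_right e_def Y_def mult.commute)
    also have "\<dots> = (\<Sum>i<n. scale (e i) (\<Sum>j<n - 1. scale (e j) (p (Y i @ [p (omit_nth j xs @ [ys ! i, xs ! j])]))))"
      by (subst sum.swap) (simp only: scale_sum_right)
    also have "\<dots> = (\<Sum>i<n. scale (e i) (p (Y i @ [A (ys ! i)]) - p (Y i @ [p (xs @ [ys ! i])])))"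
    \<comment> \<open>For fixed \<open>i\<close>, linearity in the last argument collects the sum
      over \<open>j\<close>, and \<open>sbr_snoc\<close> with \<open>u\<close> equal to
      \<open>ys ! i\<close> identifies it.\<close>
    proof (intro sum.cong refl arg_cong[where f = "scale _"])
      fix i assume "i \<in> {..<n}"
      then have i: "i < n" by simp
      interpret Ly: Vector_Spaces.linear scale scale "\<lambda>v. p (Y i @ [v])" by (rule lin[OF i])
      show "(\<Sum>j<n - 1. scale (e j) (p (Y i @ [p (omit_nth j xs @ [ys ! i, xs ! j])]))) =
          p (Y i @ [A (ys ! i)]) - p (Y i @ [p (xs @ [ys ! i])])"
        unfolding A_def sbr_snoc[OF xs] by (simp add: Ly.add Ly.sum Ly.scale e_def)
    qed
    finally show ?thesis .
  qed
  have "sbr (xs @ [sbr ys]) =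
      (\<Sum>i<n. scale (e i) ((\<Sum>m<n - 1. p ((Y i)[m := A (Y i ! m)] @ [ys ! i])) + p (Y i @ [A (ys ! i)])))"
    unfolding sbr_snoc[OF xs, of "sbr ys"] last e_def[symmetric] init
    by (simp add: sum.distrib[symmetric] scale_right_distrib[symmetric] add.commute)
  also have "\<dots> = (\<Sum>i<n. scale (e i) (\<Sum>k<n. p (omit_nth i (ys[k := A (ys ! k)]) @ [ys[k := A (ys ! k)] ! i])))"
  proof (intro sum.cong refl arg_cong[where f = "scale _"])
    fix i assume "i \<in> {..<n}"
    then have i: "i < n" by simp
    \<comment> \<open>For \<open>k = i\<close> the update changes the last argument of
      \<open>p\<close>; for \<open>k = skip i m\<close> it changes entry \<open>m\<close> of
      \<open>Y i\<close>.\<close>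
    show "(\<Sum>m<n - 1. p ((Y i)[m := A (Y i ! m)] @ [ys ! i])) + p (Y i @ [A (ys ! i)]) =
        (\<Sum>k<n. p (omit_nth i (ys[k := A (ys ! k)]) @ [ys[k := A (ys ! k)] ! i]))"
      unfolding sum_skip[OF i] using i ys
      by (simp add: Y_def omit_nth_update_skip nth_omit_nth)
  qed
  also have "\<dots> = (\<Sum>k<n. sbr (ys[k := A (ys ! k)]))"
    unfolding subadjacent_bracket_def scale_sum_right e_def by (rule sum.swap)
  finally show ?thesis by (simp add: A_def)
qed

end

section \<open>The representation by left multiplication\<close>

theorem proposition3p16:
  fixes n :: nat
    and scale :: "'k::{alg_closed_field,field_char_0} \<Rightarrow> 'g::ab_group_add \<Rightarrow> 'g"
    and p :: "'g list \<Rightarrow> 'g"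
  assumes "n_pre_Lie_algebra n scale p"
  shows "n_Lie_representation n scale (subadjacent_bracket n scale p) scale (left_mult p)"
proof -
  interpret n_pre_Lie_algebra n scale p by (rule assms)
  show ?thesis
  proof (intro n_Lie_representation.intro n_Lie_representation_axioms.intro
      n_Lie_algebra.intro n_Lie_algebra_axioms.intro)
    show "multilinear (n - 1) scale scale (\<lambda>xs. left_mult p xs v)" for v
      using p_linear_init by (simp add: multilinear_def left_mult_def)
    \<comment> \<open>This is the first identity with its last term moved to the left.\<close>
    show "left_mult p xs (left_mult p ys v) - left_mult p ys (left_mult p xs v) =
        (\<Sum>i<n - 1. left_mult p (ys[i := sbr (xs @ [ys ! i])]) v)"
      if "length xs = n - 1" "length ys = n - 1" for xs ys v
      using pre_Lie_1[OF that] by (simp add: left_mult_def)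
    show "left_mult p (xs @ [sbr ys]) v =
        (\<Sum>i<n. scale ((- 1) ^ (n - Suc i)) (left_mult p (omit_nth i ys) (left_mult p (xs @ [ys ! i]) v)))"
      if "length xs = n - 2" "length ys = n" for xs ys v
      using p_sbr[OF that] by (simp add: left_mult_def)
    show "Vector_Spaces.linear scale scale (left_mult p xs)" if "length xs = n - 1" for xs
      using p_linear_last[OF that] by (simp add: left_mult_def[abs_def])
  qed (use n_ge_2 sbr_multilinear sbr_skew sbr_fundamental_identity p_skew fin_dim_space_axioms
       in \<open>simp_all add: left_mult_def\<close>)
qed

end
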